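(* Let $\theta\in\mathbb R$ and $c=e^{2\pi i\theta}\in S^1$. Suppose $\theta\notin\mathbb Z$ and that for all $p\in\mathbb N$ and $q\in\mathbb Z$, $\theta\neq\frac{3q+1}{3(6p-1)}$ and $\theta\neq\frac{3q-1}{3(6p-1)}$. Then $$\lim_{n\to\infty}K(P_{n,c})$$ does not exist. Moreover, if in addition $\theta$ is rational, then there exist two strictly increasing infinite sequences of integers $(a_k)$ and $(b_k)$ whose ranges partition $\{n\in\mathbb N: n\geq 2\}$ such that $$\lim_{k\to\infty}K(P_{a_k,c})=S^1\quad\text{and}\quad\lim_{k\to\infty}K(P_{b_k,c})=\overline{\mathbb D}.$$
   Context: For an integer $n\ge 2$ and $c\in\mathbb C$, $P_{n,c}:\mathbb C\to\mathbb C$ is $P_{n,c}(z)=z^n+c$. The filled Julia set $K(P_{n,c})$ is the set of $z\in\mathbb C$ whose forward orbit under iteration of $P_{n,c}$ is bounded; it is a nonempty compact set. $S^1=\{z\in\mathbb C:|z|=1\}$, $\mathbb D=\{z\in\mathbb C:|z|<1\}$, $\overline{\mathbb D}$ is its closure, and $\mathbb N=\{1,2,3,\dots\}$. Limits of sets are with respect to the Hausdorff metric on nonempty compact subsets of $\mathbb C$, $d_{\mathcal H}(A,B)=\max\{\sup_{a\in A}\inf_{b\in B}|a-b|,\ \sup_{b\in B}\inf_{a\in A}|a-b|\}$: $\lim_{n\to\infty}S_n=S$ means that for all $\epsilon>0$ there is $N>0$ such that $d_{\mathcal H}(S_n,S)<\epsilon$ for all $n\ge N$; the limit does not exist if there is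 no nonempty compact $S$ with this property. *)

theory Defs
  imports "HOL-Analysis.Analysis"
begin

definition P :: "nat \<Rightarrow> complex \<Rightarrow> complex \<Rightarrow> complex" where
  "P n c z = z ^ n + c"

definition filled_julia :: "(complex \<Rightarrow> complex) \<Rightarrow> complex set" where
  "filled_julia f = {z. bounded (range (\<lambda>k. (f ^^ k) z))}"

(* Meaningful for nonempty compact A and B only: otherwise the real-valued
   suprema and infdist may take conventional values. *)
definition hausdorff_dist :: "'a::metric_space set \<Rightarrow> 'a set \<Rightarrow> real" where
  "hausdorff_dist A B = max (SUP a\<in>A. infdist a B) (SUP b\<in>B. infdist b A)"

(* Only the tail of the sequence matters, so finitely many X n may fail to be
   nonempty compact: filled_julia (P n c) is UNIV or empty for n = 0 and n = 1. *)
definition hausdorff_limit :: "(nat \<Rightarrow> 'a::metric_space set) \<Rightarrow> 'a set \<Rightarrow> bool" where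
  "hausdorff_limit X S \<longleftrightarrow>
     S \<noteq> {} \<and> compact S \<and> (\<forall>\<epsilon>>0. \<exists>N>0. \<forall>n\<ge>N. hausdorff_dist (X n) S < \<epsilon>)"

end

theory Submission
  imports Defs "HOL-Real_Asymp.Real_Asymp" "HOL-Computational_Algebra.Fundamental_Theorem_Algebra"
begin

text \<open>
  Write \<open>w\<^sub>k\<close> for the \<open>k\<close>-th iterate of the critical point \<open>0\<close> under \<open>P n c\<close>, where
  \<open>norm c = 1\<close>. For \<open>norm z \<le> r < 1\<close> the power \<open>z ^ n\<close> is exponentially small in \<open>n\<close>, whereas one
  further application of \<open>P n c\<close> near the closed unit disc enlarges an error by a factor of at
  most \<open>3 * n\<close>. So for every fixed \<open>k\<close> the \<open>k\<close>-th iterates of all points of \<open>cball 0 r\<close> are uniformly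
  close to \<open>w\<^sub>k\<close>, as long as the critical orbit has stayed in the closed unit disc before
  (\<open>eventually_orbit_near_critical_orbit\<close>). There are two consequences.

  \<^item> If \<open>w\<^sub>k\<close> leaves the unit disc by a definite amount, then all of \<open>cball 0 r\<close> escapes
    (\<open>eventually_critical_escape_imp\<close>), because points of modulus at least \<open>R > 1\<close> escape for
    large \<open>n\<close>. Then the filled Julia set lies in a thin annulus around the unit circle, and, being
    nonempty and invariant under the rotation by \<open>2 * pi / n\<close>, it is Hausdorff-close to the circle.
  \<^item> If \<open>w\<^sub>k\<close> returns to the interior of the disc by a definite amount, then the \<open>k\<close>-th iterate maps
    a disc of radius at least \<open>r\<close> into itself, and \<open>cball 0 r\<close> is contained in the filled Julia set
    (\<open>eventually_critical_return_imp\<close>).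

  Here \<open>w\<^sub>1 = c\<close> and \<open>norm w\<^sub>2 = norm (c ^ (n - 1) + 1)\<close>. Powers of \<open>c\<close> come back to a neighbourhood
  of \<open>1\<close> infinitely often, which gives infinitely many \<open>n\<close> of the first kind. The hypotheses
  exclude \<open>3 * \<theta> \<in> \<int>\<close>, so some multiple of \<open>\<theta>\<close> lies strictly in the middle third of the unit
  interval modulo \<open>1\<close>; the corresponding power of \<open>c\<close> is at distance less than \<open>1\<close> from \<open>- 1\<close>, and
  recurrence gives infinitely many \<open>n\<close> of the second kind. A limit would thus contain \<open>0\<close> while
  being close to sets that avoid a fixed disc around \<open>0\<close> (\<open>filled_julia_no_limit\<close>).

  If \<open>\<theta>\<close> is rational, \<open>norm w\<^sub>2\<close> takes finitely many values, hence is either equal to \<open>1\<close> or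
  uniformly away from \<open>1\<close>. In the first case \<open>c ^ (n - 1)\<close> is a primitive cube root of unity and the
  critical orbit can be computed: it depends on \<open>n mod 6\<close>, and \<open>w\<^sub>3\<close> or \<open>w\<^sub>4\<close> decides unless \<open>6 dvd n\<close>
  (\<open>critical_orbit_tangent_case\<close>). The remaining case \<open>n = 6 * p\<close> means that
  \<open>3 * (6 * p - 1) * \<theta>\<close> is an integer not divisible by \<open>3\<close>, which the hypotheses exclude. So every
  large \<open>n\<close> is of one of the two kinds, and the exponents are split according to whether \<open>0\<close> has a
  bounded orbit.
\<close>

section \<open>Comparison with the critical orbit\<close>

text \<open>The \<open>n\<close>-th power map expands distances by at most \<open>3 * n\<close> at scale \<open>1 / n\<close> around a point of
  the closed unit disc; the constant comes from \<open>(1 + x) ^ n \<le> exp (n * x) \<le> exp 1 \<le> 3\<close>.\<close>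
lemma norm_power_diff_near_disc:
  fixes u v :: complex
  assumes u: "norm u \<le> 1" and small: "real n * norm (v - u) \<le> 1"
  shows "norm (v ^ n - u ^ n) \<le> 3 * real n * norm (v - u)"
proof -
  define M where "M = 1 + norm (v - u)"
  have M: "M \<ge> 1" by (simp add: M_def)
  have vM: "norm v \<le> M"
    using norm_triangle_sub[of v u] u by (simp add: M_def)
  have "M ^ n \<le> exp (norm (v - u)) ^ n"
    unfolding M_def by (intro power_mono exp_ge_add_one_self) auto
  also have "\<dots> = exp (real n * norm (v - u))"
    by (simp add: exp_of_nat_mult)
  also have "\<dots> \<le> exp 1" using small by simp
  also have "\<dots> \<le> 3" by (rule exp_le)
  finally have Mn: "M ^ n \<le> 3" .
  \<comment> \<open>Scaling by \<open>M\<close> brings both points into the closed unit disc, where \<open>norm_power_diff\<close> applies.\<close>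
  have eq: "v ^ n - u ^ n = of_real (M ^ n) * ((v / of_real M) ^ n - (u / of_real M) ^ n)"
    using M by (simp add: field_simps power_divide)
  have "norm ((v / of_real M) ^ n - (u / of_real M) ^ n)
      \<le> real n * norm (v / of_real M - u / of_real M)"
    using M vM u by (intro norm_power_diff) (auto simp: norm_divide)
  also have "v / of_real M - u / of_real M = (v - u) / of_real M"
    by (simp add: diff_divide_distrib)
  also have "norm \<dots> \<le> norm (v - u)"
    using M by (simp add: norm_divide divide_le_eq mult_le_cancel_left1)
  finally have *: "norm ((v / of_real M) ^ n - (u / of_real M) ^ n) \<le> real n * norm (v - u)"
    by (simp add: mult_left_mono)
  have "norm (v ^ n - u ^ n) = M ^ n * norm ((v / of_real M) ^ n - (u / of_real M) ^ n)"
    using M unfolding eq by (simp add: norm_mult norm_power)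
  also have "\<dots> \<le> 3 * (real n * norm (v - u))"
    using Mn * M by (intro mult_mono) auto
  finally show ?thesis by (simp add: mult.assoc)
qed

text \<open>The first step contracts \<open>z\<close> and \<open>0\<close> to distance at most \<open>r ^ n\<close>; each of the following \<open>k\<close>
  steps multiplies the distance by at most \<open>3 * n\<close>.\<close>
lemma orbit_near_critical_orbit:
  assumes n: "n \<ge> 1" and z: "norm z \<le> r"
    and "(3 * real n) ^ k * r ^ n \<le> 1"
    and "\<And>j. j \<le> k \<Longrightarrow> norm ((P n c ^^ j) 0) \<le> 1"
  shows "norm ((P n c ^^ Suc k) z - (P n c ^^ Suc k) 0) \<le> (3 * real n) ^ k * r ^ n"
  using assms(3,4)
proof (induction k)
  case 0
  then show ?case using n power_mono[OF z norm_ge_zero, of n]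
    by (simp add: P_def norm_power power_0_left)
next
  case (Suc k)
  have r: "0 \<le> r" using z norm_ge_zero order_trans by blast
  define v where "v = (P n c ^^ Suc k) z"
  define u where "u = (P n c ^^ Suc k) 0"
  have "1 * ((3 * real n) ^ k * r ^ n) \<le> (3 * real n) * ((3 * real n) ^ k * r ^ n)"
    using n r by (intro mult_right_mono) auto
  moreover have "(3 * real n) ^ Suc k * r ^ n = (3 * real n) * ((3 * real n) ^ k * r ^ n)"
    by simp
  ultimately have "(3 * real n) ^ k * r ^ n \<le> 1" using Suc.prems(1) by linarith
  from Suc.IH[OF this] Suc.prems(2) have d: "norm (v - u) \<le> (3 * real n) ^ k * r ^ n"
    unfolding u_def v_def by auto
  have d3: "3 * real n * norm (v - u) \<le> (3 * real n) ^ Suc k * r ^ n"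
    using mult_left_mono[OF d, of "3 * real n"] by (simp add: mult.assoc)
  have nonneg: "0 \<le> real n * norm (v - u)" by simp
  have "norm (v ^ n - u ^ n) \<le> 3 * real n * norm (v - u)"
  proof (rule norm_power_diff_near_disc)
    show "norm u \<le> 1" using Suc.prems(2)[of "Suc k"] by (simp add: u_def)
    show "real n * norm (v - u) \<le> 1" using d3 Suc.prems(1) nonneg by linarith
  qed
  with d3 have "norm (v ^ n - u ^ n) \<le> (3 * real n) ^ Suc k * r ^ n" by linarith
  moreover have "(P n c ^^ Suc (Suc k)) x = (P n c ^^ Suc k) x ^ n + c" for x :: complex
    by (simp add: P_def)
  ultimately show ?case by (simp only: u_def v_def add_diff_cancel_right)
qed

lemma eventually_orbit_near_critical_orbit:
  assumes r: "0 < r" "r < 1" and e: "e > 0"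
  shows "\<forall>\<^sub>F n in sequentially. \<forall>k\<le>K. (\<forall>j\<le>k. norm ((P n c ^^ j) 0) \<le> 1) \<longrightarrow>
           (\<forall>z. norm z \<le> r \<longrightarrow> norm ((P n c ^^ Suc k) z - (P n c ^^ Suc k) 0) < e)"
proof -
  have "(\<lambda>n. (3 * real n) ^ K * r ^ n) \<longlonglongrightarrow> 0"
    using r by real_asymp
  hence "\<forall>\<^sub>F n in sequentially. (3 * real n) ^ K * r ^ n < min e 1"
    by (rule order_tendstoD) (use e in auto)
  with eventually_ge_at_top[of 1] show ?thesis
  proof eventually_elim
    case (elim n)
    show ?case
    proof (intro allI impI)
      fix k and z :: complex assume k: "k \<le> K" "\<forall>j\<le>k. norm ((P n c ^^ j) 0) \<le> 1" and z: "norm z \<le> r"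
      have "(3 * real n) ^ k * r ^ n \<le> (3 * real n) ^ K * r ^ n"
        using elim k r by (intro mult_right_mono power_increasing) auto
      with elim have b: "(3 * real n) ^ k * r ^ n < min e 1" by linarith
      show "norm ((P n c ^^ Suc k) z - (P n c ^^ Suc k) 0) < e"
        using orbit_near_critical_orbit[of n z r k c] elim(1) z b k(2) by force
    qed
  qed
qed

section \<open>Points of the filled Julia set\<close>

lemma filled_julia_funpow:
  assumes "z \<in> filled_julia f"
  shows "(f ^^ k) z \<in> filled_julia f"
proof -
  have "range (\<lambda>j. (f ^^ j) ((f ^^ k) z)) \<subseteq> range (\<lambda>j. (f ^^ j) z)"
    by (metis (no_types, lifting) comp_apply funpow_add image_subset_iff rangeI)
  with assms show ?thesis
    unfolding filled_julia_def using bounded_subset by blast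
qed

text \<open>Outside the ball of radius \<open>R\<close> the modulus at least doubles in each step.\<close>
lemma not_in_filled_julia:
  assumes n: "n \<ge> 1" and c: "norm c \<le> 1" and R: "R \<ge> 1" "R ^ (n - 1) \<ge> 3" and z: "norm z \<ge> R"
  shows "z \<notin> filled_julia (P n c)"
proof
  assume "z \<in> filled_julia (P n c)"
  then obtain B where B: "\<And>k. norm ((P n c ^^ k) z) \<le> B"
    unfolding filled_julia_def bounded_iff by auto
  have step: "norm (P n c w) \<ge> 2 * norm w" if w: "norm w \<ge> R" for w
  proof -
    have "3 * norm w \<le> norm w ^ (n - 1) * norm w"
      using R w by (intro mult_right_mono) (auto intro: order_trans[OF _ power_mono])
    also have "\<dots> = norm (w ^ n)" using n
      by (metis One_nat_def Suc_leD Suc_pred' norm_power not_less_eq_eq power_Suc2 less_eq_Suc_le)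
    also have "\<dots> \<le> norm (P n c w) + norm c"
      unfolding P_def using norm_triangle_ineq4[of "w ^ n + c" c] by simp
    finally show ?thesis using c R w by linarith
  qed
  have "norm ((P n c ^^ k) z) \<ge> 2 ^ k * R" for k
  proof (induction k)
    case (Suc k)
    have "1 * R \<le> 2 ^ k * R" using R by (intro mult_right_mono) auto
    hence "norm ((P n c ^^ k) z) \<ge> R" using Suc by linarith
    from step[OF this] Suc show ?case by simp
  qed (use z in simp)
  moreover have "2 ^ k * R \<ge> 2 ^ k" for k using R by simp
  ultimately have "2 ^ k \<le> B" for k using B order_trans by metis
  moreover obtain k where "B < 2 ^ k" using real_arch_pow[of 2 B] by auto
  ultimately show False by (meson not_less)
qed

lemma eventually_filled_julia_subset_ball:
  assumes c: "norm c \<le> 1" and R: "R > 1"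
  shows "\<forall>\<^sub>F n in sequentially. filled_julia (P n c) \<subseteq> ball 0 R"
proof -
  have "filterlim (\<lambda>n. R ^ (n - 1)) at_top sequentially"
    using R by real_asymp
  hence "\<forall>\<^sub>F n in sequentially. R ^ (n - 1) \<ge> 3"
    by (simp add: filterlim_at_top)
  with eventually_ge_at_top[of 1] show ?thesis
  proof eventually_elim
    case (elim n)
    show ?case using not_in_filled_julia[OF elim(1) c _ elim(2)] R
      by (force simp: not_le[symmetric])
  qed
qed

text \<open>A bound valid for every \<open>n \<ge> 2\<close>; it makes the suprema in the Hausdorff distance meaningful.\<close>
lemma filled_julia_subset_cball_3:
  assumes n: "n \<ge> 2" and c: "norm c \<le> 1"
  shows "filled_julia (P n c) \<subseteq> cball 0 3"
proof -
  have "(3::real) ^ 1 \<le> 3 ^ (n - 1)" using n by (intro power_increasing) auto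
  thus ?thesis using not_in_filled_julia[of n c 3] n c by (force simp: not_le[symmetric])
qed

text \<open>The polynomial \<open>z ^ n - z + c\<close> has a root, which is a fixed point of \<open>P n c\<close>.\<close>
lemma filled_julia_nonempty:
  assumes n: "n \<ge> 2"
  shows "filled_julia (P n c) \<noteq> {}"
proof -
  define p where "p = monom 1 n - [:- c, 1:]"
  have "poly p 2 \<noteq> poly p 0"
  proof
    assume "poly p 2 = poly p 0"
    hence "(2::complex) ^ n = 2" using n by (simp add: p_def poly_monom power_0_left)
    hence "(2::real) ^ n = 2" by (metis norm_numeral norm_power)
    thus False using n power_increasing[of 2 n "2::real"] by simp
  qed
  hence "\<not> constant (poly p)" unfolding constant_def by blast
  then obtain z where "poly p z = 0" using fundamental_theorem_of_algebra by blast
  hence fixp: "P n c z = z" by (simp add: p_def poly_monom P_def algebra_simps)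
  have "(P n c ^^ k) z = z" for k by (induction k) (auto simp: fixp)
  hence "z \<in> filled_julia (P n c)" unfolding filled_julia_def by simp
  thus ?thesis by blast
qed

lemma filled_julia_rotate:
  assumes z: "z \<in> filled_julia (P n c)" and u: "u ^ n = 1"
  shows "z * u \<in> filled_julia (P n c)"
proof -
  have "(P n c ^^ Suc k) (z * u) = (P n c ^^ Suc k) z" for k
    unfolding funpow_Suc_right comp_def by (simp add: P_def power_mult_distrib u)
  hence "range (\<lambda>k. (P n c ^^ k) (z * u)) \<subseteq> insert (z * u) (range (\<lambda>k. (P n c ^^ k) z))"
    by (smt (verit) funpow_0 image_subset_iff insertCI not0_implies_Suc rangeI)
  moreover have "bounded (insert (z * u) (range (\<lambda>k. (P n c ^^ k) z)))"
    using z by (simp add: filled_julia_def)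
  ultimately show ?thesis
    unfolding filled_julia_def using bounded_subset by blast
qed

lemma cball_subset_filled_julia:
  assumes k: "k \<ge> 1" and inv: "(P n c ^^ k) ` cball 0 r \<subseteq> cball 0 r"
  shows "cball 0 r \<subseteq> filled_julia (P n c)"
proof
  fix z :: complex assume z: "z \<in> cball 0 r"
  have cont: "continuous_on UNIV (P n c ^^ j)" for j
  proof (induction j)
    case (Suc j)
    have "continuous_on UNIV (P n c)" unfolding P_def by (intro continuous_intros)
    with Suc have "continuous_on UNIV (P n c \<circ> (P n c ^^ j))"
      by (intro continuous_on_compose) (auto intro: continuous_on_subset)
    thus ?case by simp
  qed auto
  have "bounded (\<Union>s<k. (P n c ^^ s) ` cball 0 r)"
    by (intro bounded_UN finite_lessThan ballI compact_imp_bounded compact_continuous_image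
        continuous_on_subset[OF cont] compact_cball) auto
  moreover have mult: "((P n c ^^ k) ^^ q) z \<in> cball 0 r" for q
    using z inv by (induction q) (simp_all add: image_subset_iff)
  have "(P n c ^^ m) z \<in> (\<Union>s<k. (P n c ^^ s) ` cball 0 r)" for m
  proof -
    have "(P n c ^^ m) z = (P n c ^^ (m mod k + k * (m div k))) z" by simp
    also have "\<dots> = (P n c ^^ (m mod k)) (((P n c ^^ k) ^^ (m div k)) z)"
      unfolding funpow_add funpow_mult by simp
    finally have "(P n c ^^ m) z \<in> (P n c ^^ (m mod k)) ` cball 0 r"
      using mult[of "m div k"] by blast
    moreover have "m mod k < k" using k by simp
    ultimately show ?thesis by blast
  qed
  ultimately show "z \<in> filled_julia (P n c)"
    unfolding filled_julia_def by (auto intro: bounded_subset)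
qed

section \<open>The critical orbit decides\<close>

text \<open>Within its first \<open>K + 1\<close> iterates the critical orbit leaves the closed unit disc, and at the
  first exit its modulus is at least \<open>1 + d\<close> (for \<open>d > 0\<close>). The deciding iterate has index \<open>Suc k\<close>
  with \<open>k \<le> K\<close>, so that it is never the starting point \<open>0\<close> itself.\<close>
definition critical_escape :: "nat \<Rightarrow> real \<Rightarrow> nat \<Rightarrow> complex \<Rightarrow> bool" where
  "critical_escape K d n c \<longleftrightarrow>
     (\<exists>k\<le>K. (\<forall>j\<le>k. norm ((P n c ^^ j) 0) \<le> 1) \<and> norm ((P n c ^^ Suc k) 0) \<ge> 1 + d)"

text \<open>Within its first \<open>K + 1\<close> iterates, and before leaving the closed unit disc, the critical orbit
  returns to the disc of radius \<open>1 - d\<close>. The indexing is that of \<open>critical_escape\<close>.\<close>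
definition critical_return :: "nat \<Rightarrow> real \<Rightarrow> nat \<Rightarrow> complex \<Rightarrow> bool" where
  "critical_return K d n c \<longleftrightarrow>
     (\<exists>k\<le>K. (\<forall>j\<le>k. norm ((P n c ^^ j) 0) \<le> 1) \<and> norm ((P n c ^^ Suc k) 0) \<le> 1 - d)"

lemma eventually_critical_escape_imp:
  assumes r: "r < 1" and d: "d > 0" and c: "norm c \<le> 1"
  shows "\<forall>\<^sub>F n in sequentially. critical_escape K d n c \<longrightarrow> cball 0 r \<inter> filled_julia (P n c) = {}"
proof -
  define s where "s = max r (1/2)"
  have s: "0 < s" "s < 1" "r \<le> s" using r by (auto simp: s_def)
  have "1 < 1 + d / 2" "d / 2 > 0" using d by auto
  from eventually_filled_julia_subset_ball[OF c this(1)]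
    eventually_orbit_near_critical_orbit[OF s(1,2) this(2), of K c]
  show ?thesis
  proof eventually_elim
    case (elim n)
    show ?case
    proof (intro impI equals0I)
      fix z assume esc: "critical_escape K d n c" and z: "z \<in> cball 0 r \<inter> filled_julia (P n c)"
      from esc obtain k where k: "k \<le> K" "\<forall>j\<le>k. norm ((P n c ^^ j) 0) \<le> 1"
        "norm ((P n c ^^ Suc k) 0) \<ge> 1 + d" unfolding critical_escape_def by blast
      have "norm ((P n c ^^ Suc k) z - (P n c ^^ Suc k) 0) < d / 2"
        using elim(2) k z s by auto
      with k(3) have "norm ((P n c ^^ Suc k) z) > 1 + d / 2"
        using norm_triangle_sub[of "(P n c ^^ Suc k) 0" "(P n c ^^ Suc k) z"]
        by (simp only: norm_minus_commute)
      moreover have "(P n c ^^ Suc k) z \<in> ball 0 (1 + d / 2)"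
        using filled_julia_funpow[of z _ "Suc k"] z elim(1) by blast
      ultimately show False by (simp add: dist_norm)
    qed
  qed
qed

lemma eventually_critical_return_imp:
  assumes r: "r < 1" and d: "d > 0"
  shows "\<forall>\<^sub>F n in sequentially. critical_return K d n c \<longrightarrow> cball 0 r \<subseteq> filled_julia (P n c)"
proof -
  \<comment> \<open>The radius \<open>s\<close> leaves room for an error \<open>d / 2\<close> beyond \<open>1 - d\<close>, so that \<open>cball 0 s\<close> is
      mapped into itself.\<close>
  define s where "s = max (max r (1/2)) (1 - d / 2)"
  have s: "0 < s" "s < 1" "r \<le> s" "1 - d / 2 \<le> s" using r d by (auto simp: s_def)
  have "d / 2 > 0" using d by auto
  from eventually_orbit_near_critical_orbit[OF s(1,2) this(1), of K c]
  show ?thesis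
  proof eventually_elim
    case (elim n)
    show ?case
    proof
      assume "critical_return K d n c"
      then obtain k where k: "k \<le> K" "\<forall>j\<le>k. norm ((P n c ^^ j) 0) \<le> 1"
        "norm ((P n c ^^ Suc k) 0) \<le> 1 - d" unfolding critical_return_def by blast
      have "norm ((P n c ^^ Suc k) z) \<le> s" if "norm z \<le> s" for z
      proof -
        have "norm ((P n c ^^ Suc k) z - (P n c ^^ Suc k) 0) < d / 2"
          using elim k that by auto
        with k(3) s(4) show ?thesis
          using norm_triangle_sub[of "(P n c ^^ Suc k) z" "(P n c ^^ Suc k) 0"] by linarith
      qed
      hence "cball 0 s \<subseteq> filled_julia (P n c)"
        by (intro cball_subset_filled_julia[of "Suc k"]) (auto simp del: funpow.simps)
      with s(3) show "cball 0 r \<subseteq> filled_julia (P n c)" by force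
    qed
  qed
qed

section \<open>The critical orbit for parameters on the unit circle\<close>

lemma critical_escape_mono:
  assumes "critical_escape K d n c" "K \<le> K'" "d' \<le> d"
  shows "critical_escape K' d' n c"
  using assms unfolding critical_escape_def by (meson add_left_mono order_trans)

lemma critical_return_mono:
  assumes "critical_return K d n c" "K \<le> K'" "d' \<le> d"
  shows "critical_return K' d' n c"
  using assms unfolding critical_return_def by (meson diff_left_mono order_trans)

lemma critical_orbit_1: "n \<ge> 1 \<Longrightarrow> (P n c ^^ Suc 0) 0 = c"
  by (simp add: P_def power_0_left)

lemma critical_orbit_2:
  assumes "n \<ge> 1"
  shows "(P n c ^^ Suc (Suc 0)) 0 = c * (c ^ (n - 1) + 1)"
proof -
  have "c ^ n = c * c ^ (n - 1)" using assms by (simp add: power_eq_if)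
  thus ?thesis using assms by (simp add: P_def power_0_left algebra_simps)
qed

lemma critical_escape_1I:
  assumes "norm c = 1" "n \<ge> 1" "norm (c ^ (n - 1) + 1) \<ge> 1 + d"
  shows "critical_escape 1 d n c"
  unfolding critical_escape_def
  using assms critical_orbit_1[OF assms(2), of c] critical_orbit_2[OF assms(2), of c]
  by (intro exI[of _ 1]) (auto simp: le_Suc_eq norm_mult simp del: funpow.simps(2))

lemma critical_return_1I:
  assumes "norm c = 1" "n \<ge> 1" "norm (c ^ (n - 1) + 1) \<le> 1 - d"
  shows "critical_return 1 d n c"
  unfolding critical_return_def
  using assms critical_orbit_1[OF assms(2), of c] critical_orbit_2[OF assms(2), of c]
  by (intro exI[of _ 1]) (auto simp: le_Suc_eq norm_mult simp del: funpow.simps(2))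

text \<open>The hypotheses force \<open>Re w = - 1 / 2\<close>, so \<open>w\<close> is a primitive cube root of unity.\<close>
lemma unit_sum_one_imp_cube_root:
  fixes w :: complex
  assumes "norm w = 1" "norm (w + 1) = 1"
  shows "w ^ 2 = - 1 - w" "w ^ 3 = 1" "norm (1 - w) ^ 2 = 3"
proof -
  have 1: "Re w ^ 2 + Im w ^ 2 = 1"
    using assms(1) cmod_power2[of w] by simp
  have "(Re w + 1) ^ 2 + Im w ^ 2 = 1"
    using assms(2) cmod_power2[of "w + 1"] by simp
  with 1 have re: "Re w = - 1 / 2" by (simp add: power2_eq_square algebra_simps)
  with 1 have im: "Im w ^ 2 = 3 / 4" by (simp add: power2_eq_square)
  show w2: "w ^ 2 = - 1 - w"
    using re im by (simp add: complex_eq_iff power2_eq_square)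
  have "w ^ 3 = w * w ^ 2" by (simp add: power2_eq_square power3_eq_cube)
  also have "\<dots> = - w - w ^ 2" by (subst w2) (simp add: algebra_simps power2_eq_square)
  also have "\<dots> = 1" by (subst w2) simp
  finally show "w ^ 3 = 1" .
  show "norm (1 - w) ^ 2 = 3"
    unfolding cmod_power2 using re im by (simp add: power2_eq_square)
qed

text \<open>The case \<open>norm w\<^sub>2 = 1\<close>, where the second iterate \<open>w\<^sub>2\<close> of \<open>0\<close> decides nothing. With
  \<open>\<omega> = c ^ (n - 1)\<close> one has \<open>w\<^sub>2 = - c * \<omega>\<^sup>2\<close> and \<open>c ^ n = c * \<omega>\<close>, and \<open>- \<omega>\<^sup>2\<close> is a sixth root of
  unity. The third iterate is \<open>0\<close> for \<open>n mod 6 = 1\<close> and has modulus \<open>sqrt 3\<close>, \<open>2\<close>, \<open>sqrt 3\<close> for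
  \<open>n mod 6 = 3, 4, 5\<close>. For \<open>n mod 6 = 2\<close> it is again on the circle and the fourth iterate is
  \<open>2 * c\<close>. For \<open>n mod 6 = 0\<close> the point \<open>w\<^sub>2\<close> is fixed, so neither alternative holds.\<close>
lemma critical_orbit_tangent_case:
  assumes c: "norm c = 1" and n: "n \<ge> 1" and one: "norm (c ^ (n - 1) + 1) = 1"
    and n6: "\<not> 6 dvd n"
  shows "critical_escape 3 (1/2) n c \<or> critical_return 3 (1/2) n c"
proof -
  define w where "w = c ^ (n - 1)"
  define x where "x k = (P n c ^^ k) 0" for k
  have normw: "norm w = 1" "norm (w + 1) = 1" using c one by (auto simp: w_def norm_power)
  note w2 = unit_sum_one_imp_cube_root(1)[OF normw]
  note w3 = unit_sum_one_imp_cube_root(2)[OF normw]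
  have cn: "c ^ n = c * w" using n by (simp add: w_def power_eq_if)
  have x1: "x 1 = c" using critical_orbit_1[OF n, of c] by (simp add: x_def)
  have x2: "x 2 = c * (- (w ^ 2))"
  proof -
    have "x 2 = c * (w + 1)"
      using critical_orbit_2[OF n, of c] by (simp only: x_def w_def numeral_2_eq_2)
    thus ?thesis unfolding w2 by (simp add: algebra_simps)
  qed
  have xS: "x (Suc k) = x k ^ n + c" for k by (simp add: x_def P_def)
  have step: "x (Suc k) = c * (w * v ^ n + 1)" if "x k = c * v" for k v
    unfolding xS that power_mult_distrib cn by (simp add: algebra_simps)
  have x3: "x 3 = c * (w * (- (w ^ 2)) ^ n + 1)"
    using step[OF x2] by (simp add: numeral_3_eq_3)
  have small: "norm (x j) \<le> 1" if "j \<le> 2" for j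
  proof -
    have "j = 0 \<or> j = 1 \<or> j = 2" using that by auto
    moreover have "x 0 = 0" by (simp add: x_def)
    ultimately show ?thesis using x1 x2 c normw by (auto simp: norm_mult norm_power)
  qed
  have esc3: ?thesis if "norm (x 3) \<ge> 3/2"
    unfolding critical_escape_def
    using that small by (intro disjI1 exI[of _ 2]) (auto simp: x_def numeral_3_eq_3)
  have w_pow: "w ^ (3 * j + i) = w ^ i" for i j
    by (simp add: power_add power_mult w3)
  have e6: "(- (w ^ 2)) ^ 6 = 1" 
    using w_pow[of 4 0] by (simp add: power_mult[symmetric])
  have "(- (w ^ 2)) ^ n = (- (w ^ 2)) ^ (6 * (n div 6) + n mod 6)" by simp
  also have "\<dots> = (- (w ^ 2)) ^ (n mod 6)"
    unfolding power_add power_mult e6 by simp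
  finally have red: "(- (w ^ 2)) ^ n = (- (w ^ 2)) ^ (n mod 6)" .
  have sqrt3: "norm (1 - w) \<ge> 3/2"
    by (rule power2_le_imp_le)
      (simp_all add: unit_sum_one_imp_cube_root(3)[OF normw], simp add: power2_eq_square)
  have "n mod 6 < 6" "n mod 6 \<noteq> 0" using n6 by (auto simp: dvd_eq_mod_eq_0)
  hence "n mod 6 \<in> {1,2,3,4,5}" by auto
  then consider "n mod 6 = 1" | "n mod 6 = 2" | "n mod 6 = 3" | "n mod 6 = 4" | "n mod 6 = 5"
    by blast
  thus ?thesis
  proof cases
    case 1
    have "x 3 = c * (1 - w ^ 3)"
      unfolding x3 red 1 by (simp add: power2_eq_square power3_eq_cube)
    hence "x 3 = 0" using w3 by simp
    thus ?thesis unfolding critical_return_def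
      using small by (intro disjI2 exI[of _ 2]) (auto simp: x_def numeral_3_eq_3)
  next
    case 2
    have "w * (- (w ^ 2)) ^ 2 = w ^ (3 * 1 + 2)" by (simp add: eval_nat_numeral)
    hence "x 3 = c * (w ^ 2 + 1)" unfolding x3 red 2 w_pow by simp
    hence x3': "x 3 = c * (- w)" unfolding w2 by simp
    have "(- w) ^ n = (- w) ^ (6 * (n div 6) + 2)" using 2 by (metis mult_div_mod_eq)
    also have "\<dots> = w ^ 2" 
      using w_pow[of 2 0] unfolding power_add power_mult by simp
    finally have "x 4 = c * (w * w ^ 2 + 1)" using step[OF x3'] by (simp add: eval_nat_numeral)
    also have "w * w ^ 2 = 1" using w3 by (simp add: power2_eq_square power3_eq_cube mult.assoc)
    finally have "norm (x 4) = 2" using c by (simp add: norm_mult)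
    moreover have "norm (x j) \<le> 1" if "j \<le> 3" for j
      using small[of j] that x3' c normw by (cases "j = 3") (auto simp: norm_mult)
    ultimately show ?thesis unfolding critical_escape_def
      by (intro disjI1 exI[of _ 3]) (auto simp: x_def eval_nat_numeral)
  next
    case 3
    have "w * (- (w ^ 2)) ^ 3 = - (w ^ (3 * 2 + 1))" by (simp add: eval_nat_numeral)
    hence "x 3 = c * (1 - w)" unfolding x3 red 3 w_pow by simp
    thus ?thesis using esc3 sqrt3 c by (simp add: norm_mult)
  next
    case 4
    have "w * (- (w ^ 2)) ^ 4 = w ^ (3 * 3 + 0)" by (simp add: eval_nat_numeral)
    hence "x 3 = c * 2" unfolding x3 red 4 w_pow by simp
    thus ?thesis using esc3 c by (simp add: norm_mult)
  next
    case 5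
    have "w * (- (w ^ 2)) ^ 5 = - (w ^ (3 * 3 + 2))" by (simp add: eval_nat_numeral)
    hence w5: "w * (- (w ^ 2)) ^ 5 = - (w ^ 2)" unfolding w_pow .
    have "x 3 = c * ((1 - w) * (w + 1))"
      unfolding x3 red 5 w5 by (simp add: power2_eq_square algebra_simps)
    thus ?thesis using esc3 sqrt3 c normw by (simp add: norm_mult)
  qed
qed

section \<open>Powers of a point of the unit circle\<close>

text \<open>By compactness of the circle two powers with exponents at least \<open>N\<close> apart are close; dividing
  one by the other gives a power close to \<open>1\<close>.\<close>
lemma power_recurrence:
  fixes c :: complex
  assumes c: "norm c = 1" and e: "e > 0"
  shows "\<exists>m\<ge>N. norm (c ^ m - 1) < e"
proof -
  have "\<forall>m. c ^ m \<in> sphere 0 1" using c by (simp add: norm_power)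
  then obtain l r where r: "strict_mono (r :: nat \<Rightarrow> nat)" "((\<lambda>m. c ^ m) \<circ> r) \<longlonglongrightarrow> l"
    using compact_sphere[of "0::complex" 1] unfolding compact_def by meson
  have "Cauchy ((\<lambda>m. c ^ m) \<circ> r)" using r(2) LIMSEQ_imp_Cauchy by blast
  then obtain M where M: "\<And>i j. i \<ge> M \<Longrightarrow> j \<ge> M \<Longrightarrow> norm (c ^ r i - c ^ r j) < e"
    using e unfolding Cauchy_iff comp_def by meson
  have gap: "r (M + N) \<ge> r M + N"
  proof (induction N)
    case (Suc N)
    have "r (M + N) < r (M + Suc N)" using r(1) by (simp add: strict_mono_Suc_iff)
    with Suc show ?case by simp
  qed simp
  define m where "m = r (M + N) - r M"
  have "c ^ r (M + N) = c ^ r M * c ^ m" using gap by (simp add: m_def flip: power_add)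
  hence "norm (c ^ r (M + N) - c ^ r M) = norm (c ^ r M * (c ^ m - 1))"
    by (simp add: algebra_simps)
  also have "\<dots> = norm (c ^ m - 1)" using c by (simp add: norm_mult norm_power)
  finally have "norm (c ^ m - 1) < e" using M[of "M + N" M] by simp
  moreover have "m \<ge> N" using gap by (simp add: m_def)
  ultimately show ?thesis by blast
qed

text \<open>If \<open>t\<close> is not in the middle third modulo \<open>1\<close> already, its distance from the nearest integer is
  positive and less than \<open>1/3\<close>, so its multiples move in steps too short to jump over the interval
  from \<open>1/3\<close> to \<open>2/3\<close>.\<close>
lemma multiple_in_middle_third:
  fixes t :: real
  assumes "3 * t \<notin> \<int>"
  shows "\<exists>(m::nat) (q::int). 1/3 < m * t - q \<and> m * t - q < 2/3"
proof -
  have small: "\<exists>m::nat. 1/3 < m * x \<and> m * x < 2/3" if x: "0 < x" "x < 1/3" for x :: real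
  proof -
    \<comment> \<open>The first multiple of \<open>x\<close> beyond \<open>1/3\<close>.\<close>
    define m where "m = nat \<lfloor>1 / (3 * x)\<rfloor> + 1"
    have "real m = of_int \<lfloor>1 / (3 * x)\<rfloor> + 1" using x by (simp add: m_def)
    hence "1 / (3 * x) < m" "m \<le> 1 / (3 * x) + 1" by linarith+
    hence "1/3 < m * x" "m * x \<le> 1/3 + x" using x by (auto simp: field_simps)
    thus ?thesis using x by (intro exI[of _ m]) auto
  qed
  define x where "x = frac t"
  have t: "t = x + of_int \<lfloor>t\<rfloor>" by (simp add: x_def frac_def)
  have x01: "0 \<le> x" "x < 1" by (auto simp: x_def frac_lt_1)
  have "3 * x \<notin> \<int>"
  proof
    assume "3 * x \<in> \<int>"
    hence "3 * x + 3 * of_int \<lfloor>t\<rfloor> \<in> \<int>" by (auto intro: Ints_add)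
    moreover have "3 * t = 3 * x + 3 * of_int \<lfloor>t\<rfloor>" by (subst t) simp
    ultimately show False using assms by simp
  qed
  hence "3 * x \<noteq> 0" "3 * x \<noteq> 1" "3 * x \<noteq> 2" by (auto simp: Ints_def)
  then consider "0 < x" "x < 1/3" | "1/3 < x" "x < 2/3" | "0 < 1 - x" "1 - x < 1/3"
    using x01 by linarith
  thus ?thesis
  proof cases
    case 1
    then obtain m :: nat where "1/3 < m * x" "m * x < 2/3" using small by blast
    moreover have "m * x = m * t - of_int (int m * \<lfloor>t\<rfloor>)" by (subst t) (simp add: algebra_simps)
    ultimately show ?thesis by metis
  next
    case 2
    hence "1/3 < (1::nat) * t - of_int \<lfloor>t\<rfloor>" "(1::nat) * t - of_int \<lfloor>t\<rfloor> < 2/3" 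
      using t by simp_all
    thus ?thesis by blast
  next
    case 3
    then obtain m :: nat where "1/3 < m * (1 - x)" "m * (1 - x) < 2/3" using small by blast
    moreover have "1 - m * (1 - x) = m * t - of_int (int m * \<lfloor>t\<rfloor> + int m - 1)"
      by (subst t) (simp add: algebra_simps)
    ultimately have "1/3 < m * t - of_int (int m * \<lfloor>t\<rfloor> + int m - 1)"
      "m * t - of_int (int m * \<lfloor>t\<rfloor> + int m - 1) < 2/3" by linarith+
    thus ?thesis by blast
  qed
qed

lemma norm_cis_plus_one_less:
  assumes t: "1/3 < t" "t < 2/3"
  shows "norm (cis (2 * pi * t) + 1) < 1"
proof -
  have *: "cos (2 * pi * s) < - 1 / 2" if "1/3 < s" "s \<le> 1/2" for s
  proof -
    have "cos (2 * pi * s) < cos (2 * pi / 3)"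
      using that by (intro cos_monotone_0_pi) (auto simp: field_simps)
    thus ?thesis by (simp add: cos_120)
  qed
  have "cos (2 * pi * (1 - t)) = cos (2 * pi * t)"
    by (simp add: algebra_simps cos_diff)
  hence cos: "cos (2 * pi * t) < - 1 / 2"
    using *[of t] *[of "1 - t"] t by (cases "t \<le> 1/2") auto
  have "norm (cis (2 * pi * t) + 1) ^ 2
      = (cos (2 * pi * t) ^ 2 + sin (2 * pi * t) ^ 2) + 2 * cos (2 * pi * t) + 1"
    unfolding cmod_power2 by (simp add: power2_eq_square algebra_simps)
  also have "\<dots> < 1" using cos by simp
  finally show ?thesis by (simp add: power2_less_1_iff flip: abs_square_less_1)
qed

section \<open>Hausdorff distance to the circle and to the disc\<close>

lemma hausdorff_dist_le:
  assumes "A \<noteq> {}" "B \<noteq> {}"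
    and "\<And>a. a \<in> A \<Longrightarrow> infdist a B \<le> e" "\<And>b. b \<in> B \<Longrightarrow> infdist b A \<le> e"
  shows "hausdorff_dist A B \<le> e"
  unfolding hausdorff_dist_def using assms by (auto intro!: cSUP_least)

lemma infdist_le_hausdorff_dist:
  assumes A: "bounded A" and B: "bounded B" "B \<noteq> {}" and a: "a \<in> A"
  shows "infdist a B \<le> hausdorff_dist A B" "infdist a B \<le> hausdorff_dist B A"
proof -
  obtain b where b: "b \<in> B" using B(2) by blast
  obtain r where r: "\<And>x. x \<in> A \<Longrightarrow> dist b x \<le> r"
    using A bounded_any_center[of A b] by blast
  have "bdd_above ((\<lambda>x. infdist x B) ` A)"
    using infdist_le2[OF b] r by (auto intro!: bdd_aboveI[of _ r] simp: dist_commute)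
  hence "infdist a B \<le> (SUP x\<in>A. infdist x B)" using a by (rule cSUP_upper2) auto
  thus "infdist a B \<le> hausdorff_dist A B" "infdist a B \<le> hausdorff_dist B A"
    unfolding hausdorff_dist_def by auto
qed

text \<open>Convergence along a strictly increasing sequence of indices, from an estimate for all large
  indices in its range.\<close>
lemma hausdorff_limit_subseqI:
  assumes a: "strict_mono a" and S: "S \<noteq> {}" "compact S"
    and "\<And>e. e > 0 \<Longrightarrow> \<forall>\<^sub>F n in sequentially. n \<in> range a \<longrightarrow> hausdorff_dist (X n) S < e"
  shows "hausdorff_limit (\<lambda>k. X (a k)) S"
  unfolding hausdorff_limit_def
proof (intro conjI allI impI S)
  fix e :: real assume "e > 0"
  from eventually_subseq[OF a assms(4)[OF this]]
  obtain N where "\<forall>k\<ge>N. hausdorff_dist (X (a k)) S < e"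
    unfolding eventually_sequentially by auto
  thus "\<exists>N>0. \<forall>k\<ge>N. hausdorff_dist (X (a k)) S < e"
    by (intro exI[of _ "Suc N"]) auto
qed

lemma norm_cis_diff_le: "norm (cis x - cis y) \<le> \<bar>x - y\<bar>"
proof -
  have "cis x - cis y = cis y * (cis (x - y) - 1)"
    by (simp add: algebra_simps cis_mult)
  hence "norm (cis x - cis y) = norm (cis (x - y) - 1)" by (simp add: norm_mult)
  also have "\<dots> = 2 * \<bar>sin ((x - y) / 2)\<bar>"
    using dist_exp_i_1[of "x - y"] by (simp add: cis_conv_exp)
  also have "\<dots> \<le> \<bar>x - y\<bar>" using abs_sin_x_le_abs_x[of "(x - y) / 2"] by simp
  finally show ?thesis .
qed

text \<open>The filled Julia set contains all rotations of \<open>z\<close> by multiples of \<open>2 * pi / n\<close>, and one of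
  them has its argument within \<open>2 * pi / n\<close> of that of \<open>w\<close>.\<close>
lemma filled_julia_near_circle_point:
  assumes n: "n \<ge> 1" and z: "z \<in> filled_julia (P n c)" and w: "norm w = 1"
  shows "infdist w (filled_julia (P n c)) \<le> \<bar>norm z - 1\<bar> + 2 * pi / n"
proof -
  define k where "k = \<lfloor>(Arg w - Arg z) * n / (2 * pi)\<rfloor>"
  define x where "x = 2 * pi * k / n"
  have "k \<le> (Arg w - Arg z) * n / (2 * pi)" "(Arg w - Arg z) * n / (2 * pi) < k + 1"
    unfolding k_def by linarith+
  hence "x \<le> Arg w - Arg z" "Arg w - Arg z < x + 2 * pi / n"
    using n unfolding x_def by (auto simp: field_simps)
  hence x: "\<bar>(Arg z + x) - Arg w\<bar> \<le> 2 * pi / n" by linarith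
  have "real n * x = 2 * pi * k" using n by (simp add: x_def)
  hence "cis x ^ n = cis (2 * pi * k)" by (simp only: Complex.DeMoivre)
  hence "cis x ^ n = 1" by (simp add: cis_multiple_2pi)
  hence in_K: "z * cis x \<in> filled_julia (P n c)" using filled_julia_rotate[OF z] by blast
  have "z * cis x = of_real (norm z) * cis (Arg z + x)"
    using rcis_cmod_Arg[of z] by (metis cis_mult mult.assoc rcis_def)
  moreover have "w = cis (Arg w)" using rcis_cmod_Arg[of w] w by (simp add: rcis_def)
  ultimately have "z * cis x - w
      = of_real (norm z - 1) * cis (Arg z + x) + (cis (Arg z + x) - cis (Arg w))"
    by (simp add: algebra_simps)
  hence "norm (z * cis x - w)
      \<le> norm (of_real (norm z - 1) * cis (Arg z + x)) + norm (cis (Arg z + x) - cis (Arg w))"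
    by (metis norm_triangle_ineq)
  also have "\<dots> \<le> \<bar>norm z - 1\<bar> + 2 * pi / n"
    using norm_cis_diff_le[of "Arg z + x" "Arg w"] x by (simp add: norm_mult del: of_real_diff)
  finally show ?thesis
    using infdist_le2[OF in_K, of w] by (simp add: dist_norm norm_minus_commute)
qed

lemma infdist_sphere_le:
  fixes z :: complex
  assumes "z \<noteq> 0"
  shows "infdist z (sphere 0 1) \<le> \<bar>norm z - 1\<bar>"
proof (rule infdist_le2)
  show "sgn z \<in> sphere 0 1" using assms by (simp add: norm_sgn)
  have "z = of_real (norm z) * sgn z" using assms by (simp add: sgn_eq)
  hence "z - sgn z = of_real (norm z - 1) * sgn z"
    by (metis mult_1 left_diff_distrib of_real_1 of_real_diff)
  thus "dist z (sgn z) \<le> \<bar>norm z - 1\<bar>"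
    using assms by (simp add: dist_norm norm_mult norm_sgn del: of_real_diff)
qed

lemma eventually_hausdorff_dist_circle:
  assumes c: "norm c \<le> 1" and e: "e > 0"
  shows "\<exists>r<1. \<forall>\<^sub>F n in sequentially. cball 0 r \<inter> filled_julia (P n c) = {} \<longrightarrow>
           hausdorff_dist (filled_julia (P n c)) (sphere 0 1) < e"
proof (intro exI conjI)
  define d where "d = min (e / 4) (1/2)"
  have d: "d > 0" "d < 1" "2 * d < e" using e by (auto simp: d_def min_def)
  show "1 - d < 1" using d by simp
  have "(\<lambda>n. 2 * pi / real n) \<longlonglongrightarrow> 0" by real_asymp
  hence "\<forall>\<^sub>F n in sequentially. 2 * pi / real n < d"
    by (rule order_tendstoD) (use d in auto)
  moreover have "1 < 1 + d" using d by simp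
  note eventually_filled_julia_subset_ball[OF c this]
  moreover note eventually_ge_at_top[of "2::nat"]
  ultimately show "\<forall>\<^sub>F n in sequentially. cball 0 (1 - d) \<inter> filled_julia (P n c) = {} \<longrightarrow>
           hausdorff_dist (filled_julia (P n c)) (sphere 0 1) < e"
  proof eventually_elim
    case (elim n)
    show ?case
    proof
      assume disj: "cball 0 (1 - d) \<inter> filled_julia (P n c) = {}"
      have annulus: "\<bar>norm z - 1\<bar> < d" "z \<noteq> 0" if "z \<in> filled_julia (P n c)" for z
      proof -
        have "z \<notin> cball 0 (1 - d)" "z \<in> ball 0 (1 + d)" using that disj elim by blast+
        thus "\<bar>norm z - 1\<bar> < d" "z \<noteq> 0" using d by auto
      qed
      have "hausdorff_dist (filled_julia (P n c)) (sphere 0 1) \<le> 2 * d"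
      proof (rule hausdorff_dist_le)
        show "filled_julia (P n c) \<noteq> {}" using filled_julia_nonempty elim by auto
        then obtain z where z: "z \<in> filled_julia (P n c)" by blast
        show "infdist w (filled_julia (P n c)) \<le> 2 * d" if "w \<in> sphere 0 1" for w
          using filled_julia_near_circle_point[OF _ z, of w] annulus(1)[OF z] elim that by auto
        show "infdist a (sphere 0 1) \<le> 2 * d" if "a \<in> filled_julia (P n c)" for a
          using annulus[OF that] infdist_sphere_le[of a] d by linarith
      qed auto
      thus "hausdorff_dist (filled_julia (P n c)) (sphere 0 1) < e" using d by linarith
    qed
  qed
qed

lemma eventually_hausdorff_dist_disc:
  assumes c: "norm c \<le> 1" and e: "e > 0"
  shows "\<exists>r<1. \<forall>\<^sub>F n in sequentially. cball 0 r \<subseteq> filled_julia (P n c) \<longrightarrow>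
           hausdorff_dist (filled_julia (P n c)) (cball 0 1) < e"
proof (intro exI conjI)
  define d where "d = min (e / 4) (1/2)"
  have d: "d > 0" "d < 1" "2 * d < e" using e by (auto simp: d_def min_def)
  show "1 - d < 1" using d by simp
  have "1 < 1 + d" using d by simp
  from eventually_filled_julia_subset_ball[OF c this]
  show "\<forall>\<^sub>F n in sequentially. cball 0 (1 - d) \<subseteq> filled_julia (P n c) \<longrightarrow>
           hausdorff_dist (filled_julia (P n c)) (cball 0 1) < e"
  proof eventually_elim
    case (elim n)
    show ?case
    proof
      assume sub: "cball 0 (1 - d) \<subseteq> filled_julia (P n c)"
      have "hausdorff_dist (filled_julia (P n c)) (cball 0 1) \<le> d"
      proof (rule hausdorff_dist_le)
        show "filled_julia (P n c) \<noteq> {}" using sub d by auto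
        show "infdist a (cball 0 1) \<le> d" if "a \<in> filled_julia (P n c)" for a
        proof (cases "norm a \<le> 1")
          case True
          thus ?thesis using d by simp
        next
          case False
          hence "infdist a (cball 0 1) \<le> infdist a (sphere 0 1)"
            by (intro infdist_mono) auto
          also have "\<dots> \<le> norm a - 1" using False infdist_sphere_le[of a] by fastforce
          also have "\<dots> \<le> d" using that elim by force
          finally show ?thesis .
        qed
        show "infdist b (filled_julia (P n c)) \<le> d" if "b \<in> cball 0 1" for b
        proof (rule infdist_le2)
          have "norm (of_real (1 - d) * b) = (1 - d) * norm b"
            using d by (simp add: norm_mult del: of_real_diff)
          also have "\<dots> \<le> (1 - d) * 1" using that d by (intro mult_left_mono) auto
          finally have "norm (of_real (1 - d) * b) \<le> 1 - d" by simp
          thus "of_real (1 - d) * b \<in> filled_julia (P n c)" using sub by auto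
          have "b - of_real (1 - d) * b = of_real d * b" by (simp add: algebra_simps)
          hence "dist b (of_real (1 - d) * b) = d * norm b"
            using d by (simp add: dist_norm norm_mult del: of_real_diff)
          also have "\<dots> \<le> d * 1" using that d by (intro mult_left_mono) auto
          finally show "dist b (of_real (1 - d) * b) \<le> d" by simp
        qed
      qed auto
      thus "hausdorff_dist (filled_julia (P n c)) (cball 0 1) < e" using d by linarith
    qed
  qed
qed

section \<open>Both behaviours occur infinitely often\<close>

lemma infinitely_many_critical_escape:
  assumes c: "norm c = 1"
  shows "\<exists>n\<ge>N. critical_escape 1 (1/2) n c"
proof -
  obtain m where m: "m \<ge> N" "norm (c ^ m - 1) < 1/2"
    using power_recurrence[OF c, of "1/2" N] by auto
  \<comment> \<open>\<open>2 = (c ^ m + 1) - (c ^ m - 1)\<close>\<close>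
  have "norm (2 :: complex) \<le> norm (c ^ m + 1) + norm (c ^ m - 1)"
    using norm_triangle_ineq4[of "c ^ m + 1" "c ^ m - 1"] by simp
  with m have "norm (c ^ (Suc m - 1) + 1) \<ge> 1 + 1/2" by simp
  from critical_escape_1I[OF c _ this] m show ?thesis by (intro exI[of _ "Suc m"]) auto
qed

lemma infinitely_many_critical_return:
  assumes c: "norm c = 1" and m0: "norm (c ^ m0 + 1) < 1"
  shows "\<exists>d>0. \<forall>N. \<exists>n\<ge>N. critical_return 1 d n c"
proof -
  define d where "d = (1 - norm (c ^ m0 + 1)) / 2"
  have d: "d > 0" using m0 by (simp add: d_def)
  have "\<exists>n\<ge>N. critical_return 1 d n c" for N
  proof -
    obtain m where m: "m \<ge> N" "norm (c ^ m - 1) < d"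
      using power_recurrence[OF c d, of N] by auto
    have "c ^ (m0 + m) + 1 = (c ^ m0 + 1) + c ^ m0 * (c ^ m - 1)"
      by (simp add: power_add algebra_simps)
    hence "norm (c ^ (m0 + m) + 1) \<le> norm (c ^ m0 + 1) + norm (c ^ m0 * (c ^ m - 1))"
      by (metis norm_triangle_ineq)
    also have "\<dots> = norm (c ^ m0 + 1) + norm (c ^ m - 1)"
      using c by (simp add: norm_mult norm_power)
    also have "\<dots> \<le> 1 - d" using m by (simp add: d_def field_simps)
    finally have "norm (c ^ (Suc (m0 + m) - 1) + 1) \<le> 1 - d" by simp
    from critical_return_1I[OF c _ this] m show ?thesis
      by (intro exI[of _ "Suc (m0 + m)"]) auto
  qed
  with d show ?thesis by blast
qed

lemma infinitely_many_disjoint: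
  assumes c: "norm c = 1" and r: "r < 1"
  shows "\<exists>n\<ge>N. cball 0 r \<inter> filled_julia (P n c) = {}"
proof -
  obtain M where M: "\<And>n. n \<ge> M \<Longrightarrow> critical_escape 1 (1/2) n c \<longrightarrow>
      cball 0 r \<inter> filled_julia (P n c) = {}"
    using eventually_critical_escape_imp[OF r, of "1/2" c 1] c
    unfolding eventually_sequentially by auto
  obtain n where "n \<ge> max M N" "critical_escape 1 (1/2) n c"
    using infinitely_many_critical_escape[OF c] by blast
  thus ?thesis using M[of n] by (intro exI[of _ n]) auto
qed

lemma infinitely_many_zero_in_filled_julia:
  assumes c: "norm c = 1" and m0: "norm (c ^ m0 + 1) < 1"
  shows "\<exists>n\<ge>N. 0 \<in> filled_julia (P n c)"
proof -
  obtain d where d: "d > 0" "\<And>N. \<exists>n\<ge>N. critical_return 1 d n c"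
    using infinitely_many_critical_return[OF c m0] by blast
  obtain M where M: "\<And>n. n \<ge> M \<Longrightarrow> critical_return 1 d n c \<longrightarrow>
      cball 0 0 \<subseteq> filled_julia (P n c)"
    using eventually_critical_return_imp[of 0 d 1 c] d
    unfolding eventually_sequentially by auto
  obtain n where "n \<ge> max M N" "critical_return 1 d n c"
    using d(2) by blast
  thus ?thesis using M[of n] by (intro exI[of _ n]) auto
qed

lemma filled_julia_no_limit:
  assumes c: "norm c = 1" and m0: "norm (c ^ m0 + 1) < 1"
  shows "\<nexists>S. hausdorff_limit (\<lambda>n. filled_julia (P n c)) S"
proof
  assume "\<exists>S. hausdorff_limit (\<lambda>n. filled_julia (P n c)) S"
  then obtain S where H: "hausdorff_limit (\<lambda>n. filled_julia (P n c)) S" ..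
  have S: "S \<noteq> {}" "compact S" using H by (simp_all add: hausdorff_limit_def)
  have lim: "\<exists>N. \<forall>n\<ge>N. hausdorff_dist (filled_julia (P n c)) S < e" if "e > 0" for e
    using H that unfolding hausdorff_limit_def by metis
  have bdd: "bounded (filled_julia (P n c))" if "n \<ge> 2" for n
    using filled_julia_subset_cball_3[OF that, of c] c by (auto intro: bounded_subset[OF bounded_cball])
  have Sb: "bounded S" using S by (simp add: compact_imp_bounded)
  have "infdist 0 S \<le> e" if e: "e > 0" for e
  proof -
    obtain N where N: "\<And>n. n \<ge> N \<Longrightarrow> hausdorff_dist (filled_julia (P n c)) S < e"
      using lim[OF e] by blast
    obtain n where n: "n \<ge> max N 2" "0 \<in> filled_julia (P n c)"
      using infinitely_many_zero_in_filled_julia[OF c m0] by blast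
    show ?thesis
      using infdist_le_hausdorff_dist(1)[OF bdd[of n] Sb S(1) n(2)] N[of n] n(1) by linarith
  qed
  hence "infdist 0 S \<le> 0" by (rule field_le_epsilon) simp
  hence "infdist 0 S = 0" using infdist_nonneg[of 0 S] by linarith
  hence 0: "0 \<in> S"
    using S by (simp add: in_closed_iff_infdist_zero compact_imp_closed)
  obtain N where N: "\<And>n. n \<ge> N \<Longrightarrow> hausdorff_dist (filled_julia (P n c)) S < 1/2"
    using lim[of "1/2"] by auto
  obtain n where n: "n \<ge> max N 2" and disj: "cball 0 (1/2) \<inter> filled_julia (P n c) = {}"
    using infinitely_many_disjoint[OF c, of "1/2" "max N 2"] by auto
  have ne: "filled_julia (P n c) \<noteq> {}" using filled_julia_nonempty n by simp
  have "1/2 \<le> infdist 0 (filled_julia (P n c))"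
    unfolding infdist_notempty[OF ne]
    using disj by (intro cINF_greatest[OF ne]) (force simp: disjoint_iff)
  also have "\<dots> \<le> hausdorff_dist (filled_julia (P n c)) S"
    using infdist_le_hausdorff_dist(2)[OF Sb bdd ne 0] n by simp
  also have "\<dots> < 1/2" using N n by simp
  finally show False by simp
qed

section \<open>Rational angles\<close>

text \<open>For a root of unity \<open>c\<close> the escape or return of the critical orbit happens with a margin \<open>d\<close>
  that does not depend on \<open>n\<close>.\<close>
lemma critical_orbit_dichotomy:
  assumes c: "norm c = 1" and b: "b > 0" "c ^ b = 1"
    and tangent: "\<And>n. n \<ge> 1 \<Longrightarrow> norm (c ^ (n - 1) + 1) = 1 \<Longrightarrow> \<not> 6 dvd n"
  shows "\<exists>d>0. \<forall>n\<ge>1. critical_escape 3 d n c \<or> critical_return 3 d n c"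
proof -
  define f where "f m = norm (c ^ m + 1)" for m
  have "f m = f (m mod b)" for m
  proof -
    have "c ^ m = c ^ (b * (m div b) + m mod b)" by simp
    also have "\<dots> = c ^ (m mod b)" unfolding power_add power_mult b by simp
    finally show ?thesis by (simp add: f_def)
  qed
  hence "range f \<subseteq> f ` {..<b}" using b(1) by (metis image_subsetI imageI lessThan_iff mod_less_divisor)
  hence fin: "finite (range f)" using finite_subset by blast
  \<comment> \<open>\<open>d\<close> is the least distance from \<open>1\<close> of the finitely many moduli other than \<open>1\<close>, capped by the
      \<open>1/2\<close> that the case of modulus \<open>1\<close> provides.\<close>
  define V where "V = insert (1/2) ((\<lambda>v. \<bar>v - 1\<bar>) ` (range f - {1}))"
  have V: "finite V" "V \<noteq> {}" "\<And>v. v \<in> V \<Longrightarrow> v > 0" using fin by (auto simp: V_def)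
  define d where "d = Min V"
  have d0: "d > 0" using V Min_in unfolding d_def by blast
  have dV: "d \<le> v" if "v \<in> V" for v using V that by (simp add: d_def)
  have "d \<le> 1/2" by (rule dV) (simp add: V_def)
  have "critical_escape 3 d n c \<or> critical_return 3 d n c" if n: "n \<ge> 1" for n
  proof (cases "f (n - 1) = 1")
    case True
    hence "critical_escape 3 (1/2) n c \<or> critical_return 3 (1/2) n c"
      using critical_orbit_tangent_case[OF c n] tangent[OF n] by (simp add: f_def)
    thus ?thesis
      using critical_escape_mono[of 3 "1/2" n c 3 d] critical_return_mono[of 3 "1/2" n c 3 d]
        \<open>d \<le> 1/2\<close> by auto
  next
    case False
    hence "d \<le> \<bar>f (n - 1) - 1\<bar>" by (intro dV) (auto simp: V_def)
    hence "f (n - 1) \<ge> 1 + d \<or> f (n - 1) \<le> 1 - d" by linarith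
    hence "critical_escape 1 d n c \<or> critical_return 1 d n c"
      using critical_escape_1I[OF c n] critical_return_1I[OF c n] by (auto simp: f_def)
    thus ?thesis
      using critical_escape_mono[of 1 d n c 3 d] critical_return_mono[of 1 d n c 3 d] by auto
  qed
  with d0 show ?thesis by blast
qed

text \<open>The exponents are split according to whether \<open>0\<close> lies in the filled Julia set. For large \<open>n\<close>
  an escaping critical orbit excludes \<open>0\<close> from it and a returning one puts \<open>0\<close> into it, so this
  split agrees with the dichotomy.\<close>
lemma filled_julia_two_limits:
  assumes c: "norm c = 1" and m0: "norm (c ^ m0 + 1) < 1"
    and d: "d > 0" "\<And>n. n \<ge> 1 \<Longrightarrow> critical_escape K d n c \<or> critical_return K d n c"
  shows "\<exists>a b :: nat \<Rightarrow> nat.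
         strict_mono a \<and> strict_mono b \<and>
         range a \<union> range b = {n. n \<ge> 2} \<and> range a \<inter> range b = {} \<and>
         hausdorff_limit (\<lambda>k. filled_julia (P (a k) c)) (sphere 0 1) \<and>
         hausdorff_limit (\<lambda>k. filled_julia (P (b k) c)) (cball 0 1)"
proof -
  define A where "A = {n. n \<ge> 2 \<and> 0 \<notin> filled_julia (P n c)}"
  define B where "B = {n. n \<ge> 2 \<and> 0 \<in> filled_julia (P n c)}"
  have c1: "norm c \<le> 1" using c by simp
  have "infinite A" unfolding infinite_nat_iff_unbounded_le
  proof
    fix N
    obtain n where "n \<ge> max N 2" "cball 0 (1/2) \<inter> filled_julia (P n c) = {}"
      using infinitely_many_disjoint[OF c, of "1/2" "max N 2"] by auto
    thus "\<exists>n\<ge>N. n \<in> A" by (intro exI[of _ n]) (auto simp: A_def disjoint_iff)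
  qed
  have "infinite B" unfolding infinite_nat_iff_unbounded_le
  proof
    fix N
    obtain n where "n \<ge> max N 2" "0 \<in> filled_julia (P n c)"
      using infinitely_many_zero_in_filled_julia[OF c m0] by blast
    thus "\<exists>n\<ge>N. n \<in> B" by (intro exI[of _ n]) (auto simp: B_def)
  qed
  note rng = range_enumerate[OF \<open>infinite A\<close>] range_enumerate[OF \<open>infinite B\<close>]
  note mono = strict_mono_enumerate[OF \<open>infinite A\<close>] strict_mono_enumerate[OF \<open>infinite B\<close>]
  have A: "\<forall>\<^sub>F n in sequentially. n \<in> A \<longrightarrow> cball 0 r \<inter> filled_julia (P n c) = {}"
    if "r < 1" for r
  proof -
    from eventually_critical_escape_imp[OF that d(1) c1, of K]
      eventually_critical_return_imp[of 0, OF _ d(1), of K c, simplified]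
      eventually_ge_at_top[of 1]
    show ?thesis
      by eventually_elim (use d(2) in \<open>auto simp: A_def\<close>)
  qed
  have B: "\<forall>\<^sub>F n in sequentially. n \<in> B \<longrightarrow> cball 0 r \<subseteq> filled_julia (P n c)"
    if "r < 1" for r
  proof -
    from eventually_critical_escape_imp[of 0, OF _ d(1) c1, of K, simplified]
      eventually_critical_return_imp[OF that d(1), of K c]
      eventually_ge_at_top[of 1]
    show ?thesis
      by eventually_elim (use d(2) in \<open>auto simp: B_def\<close>)
  qed
  have "hausdorff_limit (\<lambda>k. filled_julia (P (enumerate A k) c)) (sphere 0 1)"
  proof (rule hausdorff_limit_subseqI[OF mono(1)])
    fix e :: real assume "e > 0"
    then obtain r where r: "r < 1" "\<forall>\<^sub>F n in sequentially.
        cball 0 r \<inter> filled_julia (P n c) = {} \<longrightarrow>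
        hausdorff_dist (filled_julia (P n c)) (sphere 0 1) < e"
      using eventually_hausdorff_dist_circle[OF c1] by blast
    from A[OF r(1)] r(2)
    show "\<forall>\<^sub>F n in sequentially. n \<in> range (enumerate A) \<longrightarrow>
        hausdorff_dist (filled_julia (P n c)) (sphere 0 1) < e"
      unfolding rng by eventually_elim blast
  qed auto
  moreover have "hausdorff_limit (\<lambda>k. filled_julia (P (enumerate B k) c)) (cball 0 1)"
  proof (rule hausdorff_limit_subseqI[OF mono(2)])
    fix e :: real assume "e > 0"
    then obtain r where r: "r < 1" "\<forall>\<^sub>F n in sequentially.
        cball 0 r \<subseteq> filled_julia (P n c) \<longrightarrow>
        hausdorff_dist (filled_julia (P n c)) (cball 0 1) < e"
      using eventually_hausdorff_dist_disc[OF c1] by blast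
    from B[OF r(1)] r(2)
    show "\<forall>\<^sub>F n in sequentially. n \<in> range (enumerate B) \<longrightarrow>
        hausdorff_dist (filled_julia (P n c)) (cball 0 1) < e"
      unfolding rng by eventually_elim blast
  qed auto
  moreover have "A \<union> B = {n. n \<ge> 2}" "A \<inter> B = {}" by (auto simp: A_def B_def)
  ultimately show ?thesis
    using mono rng by (intro exI[of _ "enumerate A"] exI[of _ "enumerate B"]) simp
qed

text \<open>A cube root of unity other than \<open>1\<close> has an angle that is a multiple of \<open>1/3\<close> but not an
  integer, in units of full turns.\<close>
lemma tangent_angle:
  fixes t :: real
  assumes one: "norm (cis (2 * pi * t) ^ m + 1) = 1"
  shows "\<exists>q::int. 3 * (m * t) = 3 * real_of_int q + 1 \<or> 3 * (m * t) = 3 * real_of_int q - 1"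
proof -
  define w where "w = cis (2 * pi * t) ^ m"
  have w: "w = cis (2 * pi * (m * t))" by (simp add: w_def Complex.DeMoivre mult.left_commute)
  have "norm w = 1" "norm (w + 1) = 1" using one by (auto simp: w_def norm_power)
  from unit_sum_one_imp_cube_root(2)[OF this] have "cis (2 * pi * (3 * (m * t))) = 1"
    unfolding w Complex.DeMoivre by (simp add: algebra_simps)
  hence "cos (2 * pi * (3 * (m * t))) = 1" by (simp add: complex_eq_iff)
  then obtain s :: int where "2 * pi * (3 * (m * t)) = s * (2 * pi)"
    unfolding cos_one_2pi_int by (auto simp: algebra_simps)
  hence s: "3 * (m * t) = s" by (simp add: mult_ac)
  have "\<not> 3 dvd s"
  proof
    assume "3 dvd s"
    then obtain q where "s = 3 * q" by blast
    hence "m * t = q" using s by simp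
    hence "w = 1" unfolding w by (simp add: cis_multiple_2pi)
    thus False using \<open>norm (w + 1) = 1\<close> by simp
  qed
  hence "s = 3 * (s div 3) + 1 \<or> s = 3 * (s div 3 + 1) - 1" by presburger
  then obtain q where "s = 3 * q + 1 \<or> s = 3 * q - 1" by blast
  hence "real_of_int s = 3 * real_of_int q + 1 \<or> real_of_int s = 3 * real_of_int q - 1" by auto
  thus ?thesis unfolding s by blast
qed

theorem theorem1:
  fixes \<theta> :: real and c :: complex
  assumes c: "c = exp (2 * of_real pi * \<i> * of_real \<theta>)"
    and not_int: "\<theta> \<notin> \<int>"
    and excl: "\<And>(p::nat) (q::int). p \<ge> 1 \<Longrightarrow>
        \<theta> \<noteq> (3 * real_of_int q + 1) / (3 * (6 * real p - 1)) \<and>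
        \<theta> \<noteq> (3 * real_of_int q - 1) / (3 * (6 * real p - 1))"
  shows "(\<nexists>S. hausdorff_limit (\<lambda>n. filled_julia (P n c)) S) \<and>
    (\<theta> \<in> \<rat> \<longrightarrow>
      (\<exists>a b :: nat \<Rightarrow> nat.
         strict_mono a \<and> strict_mono b \<and>
         range a \<union> range b = {n. n \<ge> 2} \<and> range a \<inter> range b = {} \<and>
         hausdorff_limit (\<lambda>k. filled_julia (P (a k) c)) (sphere 0 1) \<and>
         hausdorff_limit (\<lambda>k. filled_julia (P (b k) c)) (cball 0 1)))"
proof -
  have cis: "c = cis (2 * pi * \<theta>)" unfolding c cis_conv_exp by (simp add: mult_ac)
  hence norm_c: "norm c = 1" by simp
  \<comment> \<open>The excluded values with \<open>p = 1\<close> have denominator \<open>15\<close> and contain all thirds but the integers, as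
      \<open>1/3 = 5/15\<close> and \<open>2/3 = 10/15\<close> modulo \<open>1\<close>.\<close>
  have "3 * \<theta> \<notin> \<int>"
  proof
    assume "3 * \<theta> \<in> \<int>"
    then obtain s :: int where s: "3 * \<theta> = s" by (auto elim: Ints_cases)
    have "s = 3 * (s div 3) \<or> s = 3 * (s div 3) + 1 \<or> s = 3 * (s div 3) + 2" by presburger
    then obtain q where "s = 3 * q \<or> s = 3 * q + 1 \<or> s = 3 * q + 2" by blast
    hence "3 * \<theta> = 3 * q \<or> 3 * \<theta> = 3 * q + 1 \<or> 3 * \<theta> = 3 * q + 2" using s by auto
    then consider "\<theta> = q" | "15 * \<theta> = 3 * real_of_int (5 * q + 2) - 1"
      | "15 * \<theta> = 3 * real_of_int (5 * q + 3) + 1" by fastforce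
    thus False
    proof cases
      case 1 thus False using not_int by simp
    next
      case 2 thus False using excl[of 1 "5 * q + 2"] by simp
    next
      case 3 thus False using excl[of 1 "5 * q + 3"] by simp
    qed
  qed
  then obtain m0 :: nat and q0 :: int where mq: "1/3 < m0 * \<theta> - q0" "m0 * \<theta> - q0 < 2/3"
    using multiple_in_middle_third by blast
  have "c ^ m0 = cis (2 * pi * (m0 * \<theta> - q0) + 2 * pi * q0)"
    unfolding cis Complex.DeMoivre by (simp add: algebra_simps)
  also have "\<dots> = cis (2 * pi * (m0 * \<theta> - q0))"
    by (simp add: cis_multiple_2pi flip: cis_mult)
  finally have m0: "norm (c ^ m0 + 1) < 1" using norm_cis_plus_one_less[OF mq] by simp
  have tangent: "\<not> 6 dvd n" if n: "n \<ge> 1" "norm (c ^ (n - 1) + 1) = 1" for n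
  proof
    assume "6 dvd n"
    then obtain p where p: "n = 6 * p" by blast
    with n have p1: "p \<ge> 1" by simp
    have n1: "real (n - 1) = 6 * real p - 1" using n p by simp
    obtain q :: int where "3 * ((6 * real p - 1) * \<theta>) = 3 * real_of_int q + 1
        \<or> 3 * ((6 * real p - 1) * \<theta>) = 3 * real_of_int q - 1"
      using tangent_angle[of \<theta> "n - 1"] n unfolding cis n1 by blast
    moreover have "3 * (6 * real p - 1) > 0" using p1 by simp
    ultimately have "\<theta> = (3 * real_of_int q + 1) / (3 * (6 * real p - 1))
        \<or> \<theta> = (3 * real_of_int q - 1) / (3 * (6 * real p - 1))"
      by (auto simp: field_simps)
    thus False using excl[OF p1, of q] by blast
  qed
  have "\<exists>d>0. \<forall>n\<ge>1. critical_escape 3 d n c \<or> critical_return 3 d n c" if rat: "\<theta> \<in> \<rat>"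
  proof -
    obtain s t :: int where st: "t > 0" "\<theta> = s / t" using rat by (auto elim: Rats_cases')
    define b where "b = nat t"
    have b: "b > 0" "b * \<theta> = s" using st by (auto simp: b_def)
    have "c ^ b = cis (2 * pi * (b * \<theta>))" unfolding cis Complex.DeMoivre by (simp add: mult_ac)
    also have "\<dots> = 1" unfolding b(2) by (simp add: cis_multiple_2pi)
    finally show ?thesis using critical_orbit_dichotomy[OF norm_c b(1)] tangent by blast
  qed
  with filled_julia_no_limit[OF norm_c m0] filled_julia_two_limits[OF norm_c m0]
  show ?thesis by blast
qed

end
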